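(* Let $n$ be a positive integer such that $n \geq 2$. Then $\mathcal{P}_{n+1}$ is strictly contained in $\mathcal{P}_{n}$, i.e. $\mathcal{P}_{n+1} \subsetneq \mathcal{P}_{n}$.
   Context: A real matrix $A$ is called nonnegative, written $A \geq 0$, if all its entries are nonnegative (entrywise; this does not mean positive semidefinite). For a positive integer $n$, define $\mathcal{P}_{n} := \{p \in \mathbb{R}[x] : p(A) \geq 0 \text{ for all } A \in \mathbb{R}^{n \times n} \text{ with } A \geq 0\}$, where $p(A)$ is the usual evaluation of the polynomial $p$ at the square matrix $A$ (the constant term multiplies the identity matrix $I_n$). *)

theory Defs
  imports "Jordan_Normal_Form.Matrix" "HOL-Computational_Algebra.Polynomial"
begin

(* The sum is taken in the matrix ring of dimension dim_row A, so the value is meaningful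
   only for square A; there the summand k = 0 is the constant coefficient times the identity. *)
definition poly_mat :: "'a :: comm_ring_1 poly \<Rightarrow> 'a mat \<Rightarrow> 'a mat" where
  "poly_mat p A =
     finsum (ring_mat TYPE('a) (dim_row A) ()) (\<lambda>k. coeff p k \<cdot>\<^sub>m (A ^\<^sub>m k)) {..degree p}"

lemma poly_mat_carrier [simp]:
  assumes "A \<in> carrier_mat n n"
  shows "poly_mat p A \<in> carrier_mat n n"
proof -
  interpret M: ring "ring_mat TYPE('a) n ()" by (rule ring_mat)
  have "finsum (ring_mat TYPE('a) n ()) (\<lambda>k. coeff p k \<cdot>\<^sub>m (A ^\<^sub>m k)) {..degree p}
        \<in> carrier (ring_mat TYPE('a) n ())"
    using assms by (intro M.finsum_closed) (auto simp: ring_mat_simps)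
  then show ?thesis
    using assms by (simp add: poly_mat_def ring_mat_simps)
qed

lemma index_poly_mat:
  assumes A: "A \<in> carrier_mat n n" and ij: "i < n" "j < n"
  shows "poly_mat p A $$ (i, j) = (\<Sum>k\<le>degree p. coeff p k * (A ^\<^sub>m k) $$ (i, j))"
proof -
  interpret M: ring "ring_mat TYPE('a) n ()" by (rule ring_mat)
  let ?f = "\<lambda>k. coeff p k \<cdot>\<^sub>m (A ^\<^sub>m k)"
  have f: "?f k \<in> carrier_mat n n" for k using A by simp
  have pw: "A ^\<^sub>m k \<in> carrier_mat n n" for k using A by simp
  have "finsum (ring_mat TYPE('a) n ()) ?f K \<in> carrier_mat n n \<and>
        finsum (ring_mat TYPE('a) n ()) ?f K $$ (i, j) = (\<Sum>k\<in>K. coeff p k * (A ^\<^sub>m k) $$ (i, j))"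
    if "finite K" for K
    using that
  proof (induction K)
    case empty
    then show ?case using ij by (simp add: ring_mat_simps)
  next
    case (insert k K)
    have "finsum (ring_mat TYPE('a) n ()) ?f (insert k K)
          = ?f k + finsum (ring_mat TYPE('a) n ()) ?f K"
      using insert f by (subst M.finsum_insert) (auto simp: ring_mat_simps)
    then show ?case using insert f ij pw[of k] A by auto
  qed
  from this[of "{..degree p}"] show ?thesis
    using A by (simp add: poly_mat_def)
qed

(* The order on matrices is entrywise. *)
definition nonneg_preserving_polys :: "nat \<Rightarrow> real poly set" where
  "nonneg_preserving_polys n =
     {p. \<forall>A \<in> carrier_mat n n. 0\<^sub>m n n \<le> A \<longrightarrow> 0\<^sub>m n n \<le> poly_mat p A}"

end

theory Submission
  imports Defs
begin

text \<open>
  The inclusion holds because bordering a nonnegative matrix with a zero row and a zero column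
  leaves the entries of all its powers in the old positions unchanged.

  The inclusion is strict because the coefficient of \<open>x ^ n\<close> can be negative for matrices of order
  \<open>n\<close>, but not for matrices of order \<open>n + 1\<close>: evaluated at the nilpotent shift matrix of order
  \<open>n + 1\<close>, a polynomial shows its coefficient of degree \<open>n\<close> in the upper right corner
  (\<open>coeff_nonneg_if_preserving\<close>). For matrices of order \<open>n\<close>, an entry of the \<open>n\<close>-th power is a sum
  of weights of walks with \<open>n\<close> steps. Such a walk has \<open>n + 1\<close> positions, so it contains a cycle.
  If the parts before, on and after the cycle have weights \<open>X\<close>, \<open>Y\<close>, \<open>Z\<close>, then
  \<open>X * Y * Z \<le> X * Z + X * Y\<^sup>2 * Z\<close>, and the two summands are the weights of the walk that leaves the
  cycle out and of the walk that runs through it twice. Neither has length \<open>n\<close> and both have length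
  at most \<open>2 * n\<close>. Since there are at most \<open>n ^ n\<close> walks, the other powers up to \<open>2 * n\<close>, each taken
  \<open>n ^ n\<close> times, compensate for \<open>- x ^ n\<close> (\<open>pow_order_le_sum_other_pows\<close>).
\<close>

section \<open>Walks and powers of nonnegative matrices\<close>

lemma index_pow_mat_Suc:
  fixes A :: "'a :: semiring_1 mat"
  assumes "A \<in> carrier_mat n n" "i < n" "j < n"
  shows "(A ^\<^sub>m Suc k) $$ (i, j) = (\<Sum>v<n. (A ^\<^sub>m k) $$ (i, v) * A $$ (v, j))"
proof -
  have "A ^\<^sub>m k \<in> carrier_mat n n" using assms(1) by simp
  then show ?thesis
    using assms by (auto simp: scalar_prod_def lessThan_atLeast0 intro!: sum.cong)
qed

locale nonneg_mat =
  fixes A :: "real mat" and n :: nat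
  assumes carrier: "A \<in> carrier_mat n n"
    and nonneg: "\<And>i j. i < n \<Longrightarrow> j < n \<Longrightarrow> 0 \<le> A $$ (i, j)"
begin

lemma pow_nonneg: "i < n \<Longrightarrow> j < n \<Longrightarrow> 0 \<le> (A ^\<^sub>m k) $$ (i, j)"
proof (induction k arbitrary: j)
  case 0
  then show ?case using carrier by simp
next
  case (Suc k)
  then show ?case
    unfolding index_pow_mat_Suc[OF carrier Suc.prems] by (intro sum_nonneg mult_nonneg_nonneg nonneg) auto
qed

text \<open>
  The left-hand side is the part of the entry on the right that comes from the walks which are at
  \<open>v\<close> after \<open>a\<close> steps.
\<close>

lemma pow_mult_le_pow_add:
  assumes "i < n" "v < n"
  shows "j < n \<Longrightarrow> (A ^\<^sub>m a) $$ (i, v) * (A ^\<^sub>m b) $$ (v, j) \<le> (A ^\<^sub>m (a + b)) $$ (i, j)"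
proof (induction b arbitrary: j)
  case 0
  then show ?case using carrier assms pow_nonneg by auto
next
  case (Suc b)
  have "(A ^\<^sub>m a) $$ (i, v) * (A ^\<^sub>m Suc b) $$ (v, j)
      = (\<Sum>u<n. ((A ^\<^sub>m a) $$ (i, v) * (A ^\<^sub>m b) $$ (v, u)) * A $$ (u, j))"
    unfolding index_pow_mat_Suc[OF carrier assms(2) Suc.prems]
    by (simp add: sum_distrib_left mult.assoc)
  also have "\<dots> \<le> (\<Sum>u<n. (A ^\<^sub>m (a + b)) $$ (i, u) * A $$ (u, j))"
    using Suc by (intro sum_mono mult_right_mono nonneg) auto
  also have "\<dots> = (A ^\<^sub>m (a + Suc b)) $$ (i, j)"
    using index_pow_mat_Suc[OF carrier assms(1) Suc.prems] by simp
  finally show ?case .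
qed

definition weight :: "(nat \<Rightarrow> nat) \<Rightarrow> nat \<Rightarrow> nat \<Rightarrow> real" where
  "weight f a b = (\<Prod>t = a..<b. A $$ (f t, f (Suc t)))"

lemma weight_nonneg: "(\<And>t. f t < n) \<Longrightarrow> 0 \<le> weight f a b"
  by (auto simp: weight_def intro!: prod_nonneg nonneg)

lemma weight_split: "a \<le> b \<Longrightarrow> b \<le> c \<Longrightarrow> weight f a c = weight f a b * weight f b c"
  by (simp add: weight_def prod.atLeastLessThan_concat)

lemma weight_le_pow:
  assumes f: "\<And>t. f t < n" and "a \<le> b"
  shows "weight f a b \<le> (A ^\<^sub>m (b - a)) $$ (f a, f b)"
  using \<open>a \<le> b\<close>
proof (induction b rule: dec_induct)
  case base
  then show ?case using carrier f by (simp add: weight_def)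
next
  case (step b)
  have "weight f a (Suc b) = weight f a b * A $$ (f b, f (Suc b))"
    using step by (simp add: weight_def)
  also have "\<dots> \<le> (A ^\<^sub>m (b - a)) $$ (f a, f b) * (A ^\<^sub>m 1) $$ (f b, f (Suc b))"
    using step carrier f by (auto intro!: mult_right_mono nonneg)
  also have "\<dots> \<le> (A ^\<^sub>m (b - a + 1)) $$ (f a, f (Suc b))"
    by (intro pow_mult_le_pow_add f)
  finally show ?case using step by (simp add: Suc_diff_le)
qed

text \<open>
  A single walk dominates the entry up to the factor \<open>n ^ k\<close>, so no sum over walks is needed. It is
  built backwards from its end: the predecessor is the index with the largest summand in the matrix
  product, and this summand is at least the \<open>n\<close>-th part of the sum. The entry has to be nonzero
  because there is no walk of length \<open>0\<close> between distinct indices.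
\<close>

lemma pow_le_heavy_walk:
  assumes "i < n"
  shows "j < n \<Longrightarrow> (A ^\<^sub>m k) $$ (i, j) \<noteq> 0 \<Longrightarrow>
    \<exists>f. f 0 = i \<and> f k = j \<and> (\<forall>t. f t < n) \<and> (A ^\<^sub>m k) $$ (i, j) \<le> real n ^ k * weight f 0 k"
proof (induction k arbitrary: j)
  case 0
  then have "i = j" using assms carrier by (simp split: if_splits)
  then show ?case
    using assms carrier by (intro exI[of _ "\<lambda>_. i"]) (simp add: weight_def)
next
  case (Suc k)
  define g where "g v = (A ^\<^sub>m k) $$ (i, v) * A $$ (v, j)" for v
  have "Max (g ` {..<n}) \<in> g ` {..<n}" using assms by (intro Max_in) auto
  then obtain v where v: "v < n" and "g v = Max (g ` {..<n})" by auto
  then have max: "g u \<le> g v" if "u < n" for u using that by simp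
  have pow: "(A ^\<^sub>m Suc k) $$ (i, j) = (\<Sum>u<n. g u)"
    using index_pow_mat_Suc[OF carrier assms Suc.prems(1)] by (simp add: g_def)
  also have "\<dots> \<le> (\<Sum>u<n. g v)"
    using max by (intro sum_mono) auto
  finally have le: "(A ^\<^sub>m Suc k) $$ (i, j) \<le> real n * g v" by simp
  have "0 \<le> (A ^\<^sub>m Suc k) $$ (i, j)" by (rule pow_nonneg[OF assms Suc.prems(1)])
  with le Suc.prems(2) have "g v \<noteq> 0" by auto
  then have "(A ^\<^sub>m k) $$ (i, v) \<noteq> 0" by (auto simp: g_def)
  from Suc.IH[OF v this] obtain f where f: "f 0 = i" "f k = v" "\<And>t. f t < n"
    and fle: "(A ^\<^sub>m k) $$ (i, v) \<le> real n ^ k * weight f 0 k" by auto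
  define h where "h t = (if t \<le> k then f t else j)" for t
  have "weight h 0 (Suc k) = weight h 0 k * A $$ (v, j)"
    by (simp add: weight_def h_def f)
  also have "weight h 0 k = weight f 0 k"
    unfolding weight_def by (intro prod.cong) (auto simp: h_def)
  finally have wh: "weight h 0 (Suc k) = weight f 0 k * A $$ (v, j)" .
  have "g v \<le> real n ^ k * weight h 0 (Suc k)"
    using mult_right_mono[OF fle nonneg[OF v Suc.prems(1)]]
    by (simp add: g_def wh mult.assoc)
  then have "real n * g v \<le> real n ^ Suc k * weight h 0 (Suc k)"
    using mult_left_mono[of "g v" _ "real n"] by (simp add: mult.assoc)
  with le have "(A ^\<^sub>m Suc k) $$ (i, j) \<le> real n ^ Suc k * weight h 0 (Suc k)"
    by (rule order_trans)
  moreover have "h 0 = i" "h (Suc k) = j" "\<forall>t. h t < n"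
    using f Suc.prems(1) by (auto simp: h_def)
  ultimately show ?case by blast
qed

text \<open>
  The bound \<open>Y \<le> 1 + Y\<^sup>2\<close> for the weight \<open>Y\<close> of a cycle trades one run through the cycle for none
  or two.
\<close>

lemma walk_with_cycle_le:
  assumes f: "\<And>t. f t < n" and ab: "a < b" "b \<le> c" and cyc: "f a = f b"
  shows "weight f 0 c
    \<le> (A ^\<^sub>m (c - (b - a))) $$ (f 0, f c) + (A ^\<^sub>m (c + (b - a))) $$ (f 0, f c)"
proof -
  define X Y Z where "X = weight f 0 a" and "Y = weight f a b" and "Z = weight f b c"
  note defs = X_def Y_def Z_def
  let ?l = "b - a"
  have pos: "0 \<le> X" "0 \<le> Y" "0 \<le> Z" using f by (auto simp: defs weight_nonneg)
  have X: "X \<le> (A ^\<^sub>m a) $$ (f 0, f a)" and Y: "Y \<le> (A ^\<^sub>m ?l) $$ (f a, f a)"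
    and Z: "Z \<le> (A ^\<^sub>m (c - b)) $$ (f a, f c)"
    using weight_le_pow[of f 0 a, OF f] weight_le_pow[of f a b, OF f] weight_le_pow[of f b c, OF f] ab cyc
    by (simp_all add: defs)
  have concat: "u * w \<le> (A ^\<^sub>m (k + m)) $$ (f r, f t)"
    if "u \<le> (A ^\<^sub>m k) $$ (f r, f s)" "w \<le> (A ^\<^sub>m m) $$ (f s, f t)" "0 \<le> w" for u w k m r s t
    using mult_mono[OF that(1,2) pow_nonneg[OF f f] that(3)]
    by (rule order_trans[OF _ pow_mult_le_pow_add[OF f f f]])
  have XZ: "X * Z \<le> (A ^\<^sub>m (a + (c - b))) $$ (f 0, f c)"
    by (rule concat[OF X Z pos(3)])
  have YY: "Y * Y \<le> (A ^\<^sub>m (?l + ?l)) $$ (f a, f a)"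
    by (rule concat[OF Y Y pos(2)])
  have XYY: "X * (Y * Y) \<le> (A ^\<^sub>m (a + (?l + ?l))) $$ (f 0, f a)"
    by (rule concat[OF X YY]) simp
  have XYYZ: "X * (Y * Y) * Z \<le> (A ^\<^sub>m (a + (?l + ?l) + (c - b))) $$ (f 0, f c)"
    by (rule concat[OF XYY Z pos(3)])
  have "Y \<le> 1 + Y * Y"
    using zero_le_square[of "Y - 1"] pos by (simp add: algebra_simps)
  then have "X * Z * Y \<le> X * Z * (1 + Y * Y)"
    using pos by (intro mult_left_mono) auto
  moreover have "weight f 0 c = X * Z * Y"
    using ab weight_split[of 0 b c f] weight_split[of 0 a b f] by (simp add: defs)
  ultimately have "weight f 0 c \<le> X * Z + X * (Y * Y) * Z"
    by (simp add: algebra_simps)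
  also have "\<dots> \<le> (A ^\<^sub>m (a + (c - b))) $$ (f 0, f c)
      + (A ^\<^sub>m (a + (?l + ?l) + (c - b))) $$ (f 0, f c)"
    by (rule add_mono[OF XZ XYYZ])
  also have "a + (c - b) = c - ?l"
    using ab by simp
  also have "a + (?l + ?l) + (c - b) = c + ?l"
    using ab by simp
  finally show ?thesis .
qed

text \<open>
  A heavy walk with \<open>n\<close> steps repeats an index by the pigeonhole principle, so the bound for walks
  with a cycle applies to it.
\<close>

lemma pow_order_le_sum_other_pows:
  assumes "i < n" "j < n"
  shows "(A ^\<^sub>m n) $$ (i, j) \<le> real n ^ n * (\<Sum>k\<in>{..2 * n} - {n}. (A ^\<^sub>m k) $$ (i, j))"
proof (cases "(A ^\<^sub>m n) $$ (i, j) = 0")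
  case True
  then show ?thesis using assms by (simp add: sum_nonneg pow_nonneg)
next
  case False
  from pow_le_heavy_walk[OF assms False] obtain f where f: "f 0 = i" "f n = j" "\<And>t. f t < n"
    and le: "(A ^\<^sub>m n) $$ (i, j) \<le> real n ^ n * weight f 0 n" by auto
  have "f ` {..n} \<subseteq> {..<n}" using f(3) by auto
  then have "card (f ` {..n}) \<le> n"
    using card_mono[of "{..<n}" "f ` {..n}"] by simp
  then have "\<not> inj_on f {..n}"
    by (intro pigeonhole) simp
  then obtain a b where ab: "a < b" "b \<le> n" "f a = f b"
    unfolding inj_on_def by (metis atMost_iff linorder_neqE_nat)
  let ?l = "b - a"
  have "weight f 0 n \<le> (A ^\<^sub>m (n - ?l)) $$ (i, j) + (A ^\<^sub>m (n + ?l)) $$ (i, j)"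
    using walk_with_cycle_le[OF f(3) ab] f(1,2) by simp
  also have "\<dots> = (\<Sum>k\<in>{n - ?l, n + ?l}. (A ^\<^sub>m k) $$ (i, j))"
    using ab by simp
  also have "\<dots> \<le> (\<Sum>k\<in>{..2 * n} - {n}. (A ^\<^sub>m k) $$ (i, j))"
    using ab assms by (intro sum_mono2) (auto intro: pow_nonneg)
  finally have "weight f 0 n \<le> (\<Sum>k\<in>{..2 * n} - {n}. (A ^\<^sub>m k) $$ (i, j))" .
  then have "real n ^ n * weight f 0 n \<le> real n ^ n * (\<Sum>k\<in>{..2 * n} - {n}. (A ^\<^sub>m k) $$ (i, j))"
    by (intro mult_left_mono) auto
  with le show ?thesis by simp
qed

end

section \<open>Polynomials preserving nonnegativity\<close>

lemma nonneg_preserving_iff: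
  "p \<in> nonneg_preserving_polys n \<longleftrightarrow>
    (\<forall>A i j. nonneg_mat A n \<longrightarrow> i < n \<longrightarrow> j < n \<longrightarrow>
      0 \<le> (\<Sum>k\<le>degree p. coeff p k * (A ^\<^sub>m k) $$ (i, j)))"
proof -
  have le_iff: "0\<^sub>m n n \<le> B \<longleftrightarrow> (\<forall>i<n. \<forall>j<n. 0 \<le> B $$ (i, j))"
    if "B \<in> carrier_mat n n" for B :: "real mat"
    using that by (auto simp: less_eq_mat_def)
  have "0\<^sub>m n n \<le> poly_mat p A \<longleftrightarrow>
      (\<forall>i<n. \<forall>j<n. 0 \<le> (\<Sum>k\<le>degree p. coeff p k * (A ^\<^sub>m k) $$ (i, j)))"
    if "A \<in> carrier_mat n n" for A
    using le_iff[OF poly_mat_carrier[OF that]] index_poly_mat[OF that] by simp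
  then show ?thesis
    unfolding nonneg_preserving_polys_def nonneg_mat_def using le_iff by auto
qed

lemma nonneg_preserving_antimono_Suc:
  "nonneg_preserving_polys (Suc n) \<subseteq> nonneg_preserving_polys n"
proof
  fix p assume p: "p \<in> nonneg_preserving_polys (Suc n)"
  show "p \<in> nonneg_preserving_polys n"
    unfolding nonneg_preserving_iff
  proof (intro allI impI)
    fix A i j assume A: "nonneg_mat A n" and ij: "i < n" "j < n"
    interpret nonneg_mat A n by fact
    define B where "B = four_block_mat A (0\<^sub>m n 1) (0\<^sub>m 1 n) (0\<^sub>m 1 1)"
    have B: "nonneg_mat B (Suc n)"
      using carrier nonneg by unfold_locales (auto simp: B_def)
    have "(B ^\<^sub>m k) $$ (i, j) = (A ^\<^sub>m k) $$ (i, j)" for k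
    proof -
      have "B ^\<^sub>m k = four_block_mat (A ^\<^sub>m k) (0\<^sub>m n 1) (0\<^sub>m 1 n) (0\<^sub>m 1 1 ^\<^sub>m k)"
        unfolding B_def by (rule pow_four_block_mat[OF carrier]) simp
      then show ?thesis using carrier ij by simp
    qed
    then show "0 \<le> (\<Sum>k\<le>degree p. coeff p k * (A ^\<^sub>m k) $$ (i, j))"
      using p B ij unfolding nonneg_preserving_iff by (metis (no_types, lifting) less_SucI sum.cong)
  qed
qed

text \<open>
  The \<open>k\<close>-th power of the shift matrix, the adjacency matrix of the directed path
  \<open>0 \<rightarrow> 1 \<rightarrow> \<dots> \<rightarrow> n - 1\<close>, has its ones on the \<open>k\<close>-th superdiagonal, so the first row of \<open>p\<close> at this
  matrix lists the coefficients of \<open>p\<close>.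
\<close>

lemma coeff_nonneg_if_preserving:
  assumes p: "p \<in> nonneg_preserving_polys n" and "m < n"
  shows "0 \<le> coeff p m"
proof -
  define J :: "real mat" where "J = mat n n (\<lambda>(i, j). of_bool (j = Suc i))"
  have J: "J \<in> carrier_mat n n" by (simp add: J_def)
  have row: "j < n \<Longrightarrow> (J ^\<^sub>m k) $$ (0, j) = of_bool (j = k)" for k j
  proof (induction k arbitrary: j)
    case 0
    then show ?case by (simp add: J_def)
  next
    case (Suc k)
    have "(J ^\<^sub>m Suc k) $$ (0, j) = (\<Sum>v<n. (J ^\<^sub>m k) $$ (0, v) * J $$ (v, j))"
      using Suc.prems by (intro index_pow_mat_Suc[OF J]) auto
    also have "\<dots> = (\<Sum>v<n. if v = k then of_bool (j = Suc k) else 0)"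
      using Suc by (intro sum.cong) (auto simp: J_def)
    also have "\<dots> = of_bool (j = Suc k)"
      using Suc.prems by auto
    finally show ?case .
  qed
  have "nonneg_mat J n" by unfold_locales (auto simp: J_def)
  then have "0 \<le> (\<Sum>k\<le>degree p. coeff p k * (J ^\<^sub>m k) $$ (0, m))"
    using p \<open>m < n\<close> unfolding nonneg_preserving_iff by fastforce
  also have "\<dots> = (\<Sum>k\<le>degree p. if k = m then coeff p m else 0)"
    using row[OF \<open>m < n\<close>] by (intro sum.cong) auto
  also have "\<dots> = coeff p m" by (simp add: coeff_eq_0)
  finally show ?thesis .
qed

definition separating_poly :: "nat \<Rightarrow> real poly" where
  "separating_poly n = (\<Sum>k\<le>2 * n. monom (if k = n then - 1 else real n ^ n) k)"

lemma coeff_separating_poly: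
  "coeff (separating_poly n) k = (if k = n then - 1 else if k \<le> 2 * n then real n ^ n else 0)"
  by (auto simp: separating_poly_def coeff_sum)

lemma separating_poly_preserving: "separating_poly n \<in> nonneg_preserving_polys n"
  unfolding nonneg_preserving_iff
proof (intro allI impI)
  fix A i j assume A: "nonneg_mat A n" and ij: "i < n" "j < n"
  interpret nonneg_mat A n by fact
  let ?p = "separating_poly n" and ?a = "\<lambda>k. (A ^\<^sub>m k) $$ (i, j)"
  have "degree ?p \<le> 2 * n"
    by (rule degree_le) (auto simp: coeff_separating_poly)
  then have "(\<Sum>k\<le>degree ?p. coeff ?p k * ?a k) = (\<Sum>k\<le>2 * n. coeff ?p k * ?a k)"
    by (intro sum.mono_neutral_left) (auto simp: coeff_eq_0)
  also have "\<dots> = coeff ?p n * ?a n + (\<Sum>k\<in>{..2 * n} - {n}. coeff ?p k * ?a k)"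
    by (rule sum.remove) auto
  also have "\<dots> = real n ^ n * (\<Sum>k\<in>{..2 * n} - {n}. ?a k) - ?a n"
    by (simp add: coeff_separating_poly sum_distrib_left)
  also have "\<dots> \<ge> 0"
    using pow_order_le_sum_other_pows[OF ij] by simp
  finally show "0 \<le> (\<Sum>k\<le>degree ?p. coeff ?p k * ?a k)" .
qed

theorem corollary3:
  fixes n :: nat
  assumes "n \<ge> 2"
  shows "nonneg_preserving_polys (n + 1) \<subset> nonneg_preserving_polys n"
proof
  show "nonneg_preserving_polys (n + 1) \<subseteq> nonneg_preserving_polys n"
    using nonneg_preserving_antimono_Suc by simp
  have "separating_poly n \<notin> nonneg_preserving_polys (n + 1)"
    using coeff_nonneg_if_preserving[of "separating_poly n" "n + 1" n]
    by (auto simp: coeff_separating_poly)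
  with separating_poly_preserving
  show "nonneg_preserving_polys (n + 1) \<noteq> nonneg_preserving_polys n" by blast
qed

end
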